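(* Let $Q=(X,A)$ be a relative simplicial complex (i.e. $X$ is a simplicial complex, $A\subseteq X$ is a subcomplex, and $Q=X\setminus A$) such that (i) $X$ and $A$ are Cohen--Macaulay; (ii) $A$ is an induced subcomplex of $X$ of codimension at most $1$ (i.e. $\dim A\geq \dim X-1$); and (iii) $Q$ is not partitionable. Let $k$ be the total number of faces of $A$ (including the empty face), let $N>k$ be an integer, and let $C=C_N$ be the simplicial complex constructed from $N$ disjoint copies of $X$ by identifying them along the subcomplex $A$. Then $C$ is Cohen--Macaulay and not partitionable.
   Context: All complexes are finite. A simplicial complex on a finite set $V$ is a collection $\Delta$ of subsets of $V$ (faces) closed under taking subsets; maximal faces are called facets; $\dim\sigma=|\sigma|-1$ and $\dim\Delta=\max_{\sigma\in\Delta}\dim\sigma$; $\Delta$ is pure if all facets have the same dimension. A subcomplex is a subset of $\Delta$ that is a simplicial complex; it is induced if it has the form $\Delta|_W=\{\sigma\in\Delta : \sigma\subseteq W\}$ for some $W\subseteq V$. A relative simplicial complex is a family $\Phi=(\Delta,\Gamma):=\Delta\setminus\Gamma$ with $\Gamma$ a subcomplex of a simplicial complex $\Delta$ (equivalently, a convex subset of $2^V$); its facets are its inclusion-maximal elements. Link: $\mathrm{link}_\Delta(\sigma)=\{\tau\in\Delta : \tau\cap\sigma=\emptyset,\ \tau\cup\sigma\in\Delta\}$. A simplicial complex $\Delta$ is Cohen--Macaulay if for every face $\sigma\in\Delta$ (including $\sigma=\emptyset$), $\tilde H_i(\mathrm{link}_\Delta(\sigma))=0$ for all $i<\dim\mathrm{link}_\Delta(\sigma)$,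 where $\tilde H_i$ is reduced simplicial homology with coefficients in $\mathbb{Z}$. Partitionability: a pure complex $\Delta$ (absolute or relative) with facets $F_1,\dots,F_n$ is partitionable if there are $R_1,\dots,R_n\in\Delta$ with $R_i\subseteq F_i$ such that $\Delta=\bigsqcup_{i=1}^n [R_i,F_i]$ (disjoint union), where $[R_i,F_i]=\{\sigma\in\Delta : R_i\subseteq\sigma\subseteq F_i\}$. (In the relative case every set between $R_i$ and $F_i$ lies in $\Delta$ automatically, by convexity.) Gluing: take $N$ copies of $X$ on disjoint vertex sets and, for each vertex $v$ of $A$, identify the $N$ copies of $v$ to a single vertex (so that the $N$ copies of $A$ become one). Since $A$ is induced, the faces of the resulting complex $C_N$ are the images of the faces of the copies of $X$, and any two copies of $X$ intersect exactly in $A$. *)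

theory Defs
  imports
    "HOL-Algebra.Elementary_Groups"
    "HOL-Combinatorics.Permutations"
    "HOL-Library.Disjoint_Sets"
begin

section \<open>Simplicial complexes\<close>

text \<open>
  A complex is given by its set of faces. Its ground set is left implicit: elements of the ground
  set that lie in no face never matter, so the union of the faces is used throughout.
\<close>

definition vertices :: "'a set set \<Rightarrow> 'a set" where
  "vertices \<Delta> = \<Union>\<Delta>"

definition simplicial_complex :: "'a set set \<Rightarrow> bool" where
  "simplicial_complex \<Delta> \<longleftrightarrow> finite (vertices \<Delta>) \<and> (\<forall>\<sigma>\<in>\<Delta>. \<forall>\<tau>. \<tau> \<subseteq> \<sigma> \<longrightarrow> \<tau> \<in> \<Delta>)"

definition subcomplex :: "'a set set \<Rightarrow> 'a set set \<Rightarrow> bool" where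
  "subcomplex \<Gamma> \<Delta> \<longleftrightarrow> \<Gamma> \<subseteq> \<Delta> \<and> simplicial_complex \<Gamma>"

definition induced_subcomplex :: "'a set set \<Rightarrow> 'a set set \<Rightarrow> bool" where
  "induced_subcomplex \<Gamma> \<Delta> \<longleftrightarrow> (\<exists>W \<subseteq> vertices \<Delta>. \<Gamma> = {\<sigma>\<in>\<Delta>. \<sigma> \<subseteq> W})"

text \<open>The relative complex \<open>(\<Delta>, \<Gamma>)\<close> is the family of faces \<open>\<Delta> - \<Gamma>\<close>.\<close>

definition relative_complex :: "'a set set \<Rightarrow> 'a set set \<Rightarrow> bool" where
  "relative_complex \<Delta> \<Gamma> \<longleftrightarrow> simplicial_complex \<Delta> \<and> subcomplex \<Gamma> \<Delta>"

definition face_dim :: "'a set \<Rightarrow> int" where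
  "face_dim \<sigma> = int (card \<sigma>) - 1"

text \<open>Only meaningful for a nonempty finite family; \<open>{{}}\<close> has dimension \<open>-1\<close>.\<close>

definition complex_dim :: "'a set set \<Rightarrow> int" where
  "complex_dim \<Delta> = Max (face_dim ` \<Delta>)"

definition facets :: "'a set set \<Rightarrow> 'a set set" where
  "facets \<Delta> = {F\<in>\<Delta>. \<forall>\<sigma>\<in>\<Delta>. F \<subseteq> \<sigma> \<longrightarrow> \<sigma> = F}"

definition pure :: "'a set set \<Rightarrow> bool" where
  "pure \<Delta> \<longleftrightarrow> (\<forall>F\<in>facets \<Delta>. \<forall>G\<in>facets \<Delta>. face_dim F = face_dim G)"

definition link :: "'a set set \<Rightarrow> 'a set \<Rightarrow> 'a set set" where
  "link \<Delta> \<sigma> = {\<tau>\<in>\<Delta>. \<tau> \<inter> \<sigma> = {} \<and> \<tau> \<union> \<sigma> \<in> \<Delta>}"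


section \<open>Reduced simplicial homology with integer coefficients\<close>

text \<open>
  An oriented \<open>i\<close>-simplex is an \<open>i\<close>-face with an ordering of its \<open>i + 1\<close> vertices, where an odd
  permutation reverses the orientation. An \<open>i\<close>-chain \<open>f\<close> is an alternating integer function on
  orderings of \<open>i\<close>-faces (extended by zero to all other lists), \<open>f xs\<close> being the coefficient of the
  oriented simplex \<open>xs\<close>. The empty face, with its one ordering \<open>[]\<close>, is the simplex of degree \<open>-1\<close>
  that makes the homology reduced.
\<close>

definition oriented_chains :: "'a set set \<Rightarrow> int \<Rightarrow> ('a list \<Rightarrow> int) set" where
  "oriented_chains \<Delta> i =
     {f. (\<forall>xs. f xs \<noteq> 0 \<longrightarrow> distinct xs \<and> set xs \<in> \<Delta> \<and> face_dim (set xs) = i) \<and>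
         (\<forall>xs \<pi>. \<pi> permutes {..<length xs} \<longrightarrow> f (permute_list \<pi> xs) = sign \<pi> * f xs)}"

text \<open>
  This is the usual boundary
  \<open>\<partial>[v\<^sub>0,\<dots>,v\<^sub>p] = (\<Sum>j\<le>p. (-1)^j [v\<^sub>0,\<dots>,v\<^sub>j\<^sub>-\<^sub>1,v\<^sub>j\<^sub>+\<^sub>1,\<dots>,v\<^sub>p])\<close>
  read off coefficientwise: as \<open>[v\<^sub>0,\<dots>,v\<^sub>p] = (-1)^j [v\<^sub>j,v\<^sub>0,\<dots>,v\<^sub>j\<^sub>-\<^sub>1,v\<^sub>j\<^sub>+\<^sub>1,\<dots>,v\<^sub>p]\<close>, the
  simplex \<open>xs\<close> occurs in the boundary of \<open>v # xs\<close> with coefficient \<open>1\<close>.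
\<close>

definition boundary_map :: "'a set set \<Rightarrow> ('a list \<Rightarrow> int) \<Rightarrow> 'a list \<Rightarrow> int" where
  "boundary_map \<Delta> f xs = (\<Sum>v\<in>vertices \<Delta>. f (v # xs))"

definition cycles :: "'a set set \<Rightarrow> int \<Rightarrow> ('a list \<Rightarrow> int) set" where
  "cycles \<Delta> i = {f\<in>oriented_chains \<Delta> i. boundary_map \<Delta> f = (\<lambda>_. 0)}"

definition boundaries :: "'a set set \<Rightarrow> int \<Rightarrow> ('a list \<Rightarrow> int) set" where
  "boundaries \<Delta> i = boundary_map \<Delta> ` oriented_chains \<Delta> (i + 1)"

definition cycle_group :: "'a set set \<Rightarrow> int \<Rightarrow> ('a list \<Rightarrow> int) monoid" where
  "cycle_group \<Delta> i =
     \<lparr>carrier = cycles \<Delta> i, monoid.mult = (\<lambda>f g xs. f xs + g xs), one = (\<lambda>_. 0)\<rparr>"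

definition reduced_homology :: "'a set set \<Rightarrow> int \<Rightarrow> ('a list \<Rightarrow> int) set monoid" where
  "reduced_homology \<Delta> i = cycle_group \<Delta> i Mod boundaries \<Delta> i"

definition cohen_macaulay :: "'a set set \<Rightarrow> bool" where
  "cohen_macaulay \<Delta> \<longleftrightarrow> simplicial_complex \<Delta> \<and>
     (\<forall>\<sigma>\<in>\<Delta>. \<forall>i < complex_dim (link \<Delta> \<sigma>). trivial_group (reduced_homology (link \<Delta> \<sigma>) i))"


section \<open>Partitionability\<close>

definition face_interval :: "'a set set \<Rightarrow> 'a set \<Rightarrow> 'a set \<Rightarrow> 'a set set" where
  "face_interval \<Delta> R F = {\<sigma>\<in>\<Delta>. R \<subseteq> \<sigma> \<and> \<sigma> \<subseteq> F}"

text \<open>Applies to absolute and relative complexes alike.\<close>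

definition partitionable :: "'a set set \<Rightarrow> bool" where
  "partitionable \<Delta> \<longleftrightarrow> pure \<Delta> \<and>
     (\<exists>R. (\<forall>F\<in>facets \<Delta>. R F \<in> \<Delta> \<and> R F \<subseteq> F) \<and>
          disjoint_family_on (\<lambda>F. face_interval \<Delta> (R F) F) (facets \<Delta>) \<and>
          (\<Union>F\<in>facets \<Delta>. face_interval \<Delta> (R F) F) = \<Delta>)"


section \<open>Gluing copies along a subcomplex\<close>

text \<open>
  Vertices of the quotient: \<open>Inl v\<close> is the common image of all the copies of a vertex \<open>v\<close> of \<open>A\<close>,
  and \<open>Inr (v, j)\<close> is the \<open>j\<close>-th copy of a vertex \<open>v\<close> not in \<open>A\<close>.
\<close>

definition copy_vertex :: "'a set set \<Rightarrow> nat \<Rightarrow> 'a \<Rightarrow> 'a + 'a \<times> nat" where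
  "copy_vertex A j v = (if v \<in> vertices A then Inl v else Inr (v, j))"

definition glue_copies :: "'a set set \<Rightarrow> 'a set set \<Rightarrow> nat \<Rightarrow> ('a + 'a \<times> nat) set set" where
  "glue_copies X A N = (\<Union>j<N. (\<lambda>\<sigma>. copy_vertex A j ` \<sigma>) ` X)"

end

theory Submission
  imports Defs
begin

text \<open>
  A Mayer--Vietoris argument shows that the union of two Cohen--Macaulay complexes of dimension
  \<open>d\<close> is Cohen--Macaulay if their intersection is and has dimension at least \<open>d - 1\<close>: links commute
  with unions and intersections, and purity controls the dimensions of all links involved. Adding
  the copies of \<open>X\<close> one at a time, each meeting the previous ones in \<open>A\<close>, gives the first claim.
  In a partition of the glued complex at most \<open>card A < N\<close> intervals start in \<open>A\<close>, so some copy of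
  \<open>X - A\<close> is itself partitioned by the intervals below its facets.
\<close>

section \<open>Chains\<close>

text \<open>The Cohen--Macaulay condition speaks of homology alone, so purity is not part of it and
  has to be extracted; at each stage of that induction only degree 0, that is connectedness, is
  consumed. Gluing relies on purity because at a face of the intersection the link in one piece
  could otherwise have smaller dimension than the link in the union, which would leave some relevant
  degree uncontrolled. Mayer--Vietoris meets the intersection one degree lower than the pieces;
  codimension at most 1 is exactly this slack. On the combinatorial side the obstacle is an interval
  that starts in \<open>A\<close> and ends outside: its part outside \<open>A\<close> has no bottom
  in \<open>X - A\<close> to inherit. A face is the bottom of at most one interval, and the top of
  an interval ending outside \<open>A\<close> lies in one copy only. So each face of
  \<open>A\<close>, the empty one included, spoils at most one copy, whence the bound
  \<open>card A\<close>.\<close>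

lemma oriented_chainsI:
  assumes "\<And>xs. f xs \<noteq> 0 \<Longrightarrow> distinct xs \<and> set xs \<in> \<Delta> \<and> face_dim (set xs) = i"
    and "\<And>xs \<pi>. \<pi> permutes {..<length xs} \<Longrightarrow> f (permute_list \<pi> xs) = sign \<pi> * f xs"
  shows "f \<in> oriented_chains \<Delta> i"
  using assms unfolding oriented_chains_def by blast

lemma oriented_chains_support:
  assumes "f \<in> oriented_chains \<Delta> i" "f xs \<noteq> 0"
  shows "distinct xs" "set xs \<in> \<Delta>" "face_dim (set xs) = i"
  using assms unfolding oriented_chains_def by blast+

lemma oriented_chains_permute:
  assumes "f \<in> oriented_chains \<Delta> i" "\<pi> permutes {..<length xs}"
  shows "f (permute_list \<pi> xs) = sign \<pi> * f xs"
  using assms unfolding oriented_chains_def by blast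

text \<open>The vertices added by two boundary maps stand at the front of the list, so this single
  transposition drives the cancellation in double sums.\<close>

lemma oriented_chains_swap:
  assumes "f \<in> oriented_chains \<Delta> i"
  shows "f (w # v # xs) = - f (v # w # xs)"
proof -
  let ?\<pi> = "transpose 0 (1::nat)"
  have p: "?\<pi> permutes {..<length (v # w # xs)}"
    by (intro permutes_swap_id) auto
  have "permute_list ?\<pi> (v # w # xs) = w # v # xs"
  proof (rule nth_equalityI)
    fix k assume "k < length (permute_list ?\<pi> (v # w # xs))"
    then show "permute_list ?\<pi> (v # w # xs) ! k = (w # v # xs) ! k"
      using p by (cases k; cases "k - 1") (auto simp: permute_list_nth transpose_def)
  qed simp
  with oriented_chains_permute[OF assms p] show ?thesis
    by (simp add: sign_swap_id)
qed

lemma oriented_chains_zero: "(\<lambda>_. 0) \<in> oriented_chains \<Delta> i"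
  by (rule oriented_chainsI) auto

lemma oriented_chains_add:
  assumes "f \<in> oriented_chains \<Delta> i" "g \<in> oriented_chains \<Delta> i"
  shows "(\<lambda>xs. f xs + g xs) \<in> oriented_chains \<Delta> i"
proof (rule oriented_chainsI)
  fix xs assume "f xs + g xs \<noteq> 0"
  then have "f xs \<noteq> 0 \<or> g xs \<noteq> 0" by auto
  then show "distinct xs \<and> set xs \<in> \<Delta> \<and> face_dim (set xs) = i"
    using assms oriented_chains_support by blast
next
  fix xs :: "'a list" and \<pi> assume "\<pi> permutes {..<length xs}"
  then show "f (permute_list \<pi> xs) + g (permute_list \<pi> xs) = sign \<pi> * (f xs + g xs)"
    using assms by (simp add: oriented_chains_permute distrib_left)
qed

lemma oriented_chains_uminus:
  assumes "f \<in> oriented_chains \<Delta> i"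
  shows "(\<lambda>xs. - f xs) \<in> oriented_chains \<Delta> i"
  using assms by (intro oriented_chainsI) (auto simp: oriented_chains_support oriented_chains_permute)

lemma oriented_chains_diff:
  assumes "f \<in> oriented_chains \<Delta> i" "g \<in> oriented_chains \<Delta> i"
  shows "(\<lambda>xs. f xs - g xs) \<in> oriented_chains \<Delta> i"
  using oriented_chains_add[OF assms(1) oriented_chains_uminus[OF assms(2)]] by simp

lemma oriented_chains_mono:
  assumes "f \<in> oriented_chains \<Gamma> i" "\<Gamma> \<subseteq> \<Delta>"
  shows "f \<in> oriented_chains \<Delta> i"
  using assms unfolding oriented_chains_def by blast

text \<open>Permuting a list keeps its underlying set, so cutting a chain down by a property of that
  set keeps it alternating. This is how a chain is split between two subcomplexes.\<close>

lemma oriented_chains_restrict: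
  assumes "f \<in> oriented_chains \<Delta> i"
  shows "(\<lambda>xs. if P (set xs) then f xs else 0) \<in> oriented_chains {\<sigma>\<in>\<Delta>. P \<sigma>} i"
  using assms
  by (intro oriented_chainsI) (auto simp: oriented_chains_support oriented_chains_permute split: if_splits)

lemma boundary_map_zero: "boundary_map \<Delta> (\<lambda>_. 0) = (\<lambda>_. 0)"
  by (simp add: boundary_map_def fun_eq_iff)

lemma boundary_map_add:
  "boundary_map \<Delta> (\<lambda>xs. f xs + g xs) = (\<lambda>xs. boundary_map \<Delta> f xs + boundary_map \<Delta> g xs)"
  by (simp add: boundary_map_def fun_eq_iff sum.distrib)

lemma boundary_map_uminus:
  "boundary_map \<Delta> (\<lambda>xs. - f xs) = (\<lambda>xs. - boundary_map \<Delta> f xs)"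
  by (simp add: boundary_map_def fun_eq_iff sum_negf)

lemma boundary_map_diff:
  "boundary_map \<Delta> (\<lambda>xs. f xs - g xs) = (\<lambda>xs. boundary_map \<Delta> f xs - boundary_map \<Delta> g xs)"
  by (simp add: boundary_map_def fun_eq_iff sum_subtractf)

text \<open>A vertex outside \<Gamma> lies in no face of \<Gamma>, so it adds zero terms. Boundaries
  of chains of subcomplexes may thus all be taken in one ambient complex.\<close>

lemma boundary_map_mono:
  assumes "f \<in> oriented_chains \<Gamma> i" "\<Gamma> \<subseteq> \<Delta>" "finite (vertices \<Delta>)"
  shows "boundary_map \<Delta> f = boundary_map \<Gamma> f"
proof
  fix xs
  have "f (v # xs) = 0" if "v \<notin> vertices \<Gamma>" for v
    using oriented_chains_support(2)[OF assms(1), of "v # xs"] that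
    unfolding vertices_def by auto
  moreover have "vertices \<Gamma> \<subseteq> vertices \<Delta>"
    using assms(2) unfolding vertices_def by blast
  ultimately show "boundary_map \<Delta> f xs = boundary_map \<Gamma> f xs"
    unfolding boundary_map_def using assms(3) by (intro sum.mono_neutral_right) auto
qed

lemma simplicial_complexD:
  assumes "simplicial_complex \<Delta>"
  shows "finite (vertices \<Delta>)" "\<sigma> \<in> \<Delta> \<Longrightarrow> \<tau> \<subseteq> \<sigma> \<Longrightarrow> \<tau> \<in> \<Delta>"
  using assms unfolding simplicial_complex_def by blast+

lemma simplicial_complex_finite:
  assumes "simplicial_complex \<Delta>"
  shows "finite \<Delta>" "\<sigma> \<in> \<Delta> \<Longrightarrow> finite \<sigma>"
proof -
  have "\<Delta> \<subseteq> Pow (vertices \<Delta>)" unfolding vertices_def by blast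
  then show "finite \<Delta>" "\<sigma> \<in> \<Delta> \<Longrightarrow> finite \<sigma>"
    using simplicial_complexD(1)[OF assms] by (auto intro: finite_subset)
qed

lemma boundary_map_chain:
  assumes \<Delta>: "simplicial_complex \<Delta>" and f: "f \<in> oriented_chains \<Delta> i"
  shows "boundary_map \<Delta> f \<in> oriented_chains \<Delta> (i - 1)"
proof (rule oriented_chainsI)
  fix xs assume "boundary_map \<Delta> f xs \<noteq> 0"
  then obtain v where v: "f (v # xs) \<noteq> 0"
    unfolding boundary_map_def by (meson sum.not_neutral_contains_not_neutral)
  note support = oriented_chains_support[OF f v]
  have "set xs \<in> \<Delta>" using simplicial_complexD(2)[OF \<Delta> support(2)] by auto
  then show "distinct xs \<and> set xs \<in> \<Delta> \<and> face_dim (set xs) = i - 1"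
    using support by (auto simp: face_dim_def)
next
  fix xs :: "'a list" and \<pi> assume \<pi>: "\<pi> permutes {..<length xs}"
  \<comment> \<open>\<rho> acts as \<pi> on the tail of \<open>v # xs\<close> and fixes the head,
    with the same sign.\<close>
  define \<rho> where "\<rho> = map_permutation {..<length xs} Suc \<pi>"
  have "bij_betw Suc {..<length xs} {1..<Suc (length xs)}"
    by (simp add: bij_betw_def lessThan_atLeast0)
  then have "\<rho> permutes {1..<Suc (length xs)}"
    unfolding \<rho>_def by (intro map_permutation_permutes \<pi>)
  then have \<rho>: "\<rho> permutes {..<length (v # xs)}" for v :: 'a
    by (rule permutes_subset) auto
  have "\<rho> 0 = 0"
    using \<open>\<rho> permutes {1..<Suc (length xs)}\<close> by (rule permutes_not_in) auto
  have "\<rho> (Suc k) = Suc (\<pi> k)" if "k < length xs" for k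
    unfolding \<rho>_def using that by (intro map_permutation_apply) auto
  then have "permute_list \<rho> (v # xs) = v # permute_list \<pi> xs" for v
    using \<rho>[of v] \<pi> \<open>\<rho> 0 = 0\<close>
    by (intro nth_equalityI) (auto simp: permute_list_nth nth_Cons split: nat.splits)
  moreover have "sign \<rho> = sign \<pi>"
    unfolding \<rho>_def by (intro sign_map_permutation \<pi>) auto
  ultimately have "f (v # permute_list \<pi> xs) = sign \<pi> * f (v # xs)" for v
    using oriented_chains_permute[OF f \<rho>] by metis
  then show "boundary_map \<Delta> f (permute_list \<pi> xs) = sign \<pi> * boundary_map \<Delta> f xs"
    by (simp add: boundary_map_def sum_distrib_left)
qed

text \<open>The double sum over two added vertices is antisymmetric in them, so it is an integer
  equal to its own negative.\<close>

lemma boundary_map_boundary_map: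
  assumes "f \<in> oriented_chains \<Delta> i"
  shows "boundary_map \<Delta> (boundary_map \<Delta> f) = (\<lambda>_. 0)"
proof
  fix xs
  let ?V = "vertices \<Delta>"
  have "(\<Sum>v\<in>?V. \<Sum>w\<in>?V. f (w # v # xs)) = (\<Sum>v\<in>?V. \<Sum>w\<in>?V. - f (v # w # xs))"
    by (intro sum.cong refl oriented_chains_swap[OF assms])
  also have "\<dots> = - (\<Sum>w\<in>?V. \<Sum>v\<in>?V. f (v # w # xs))"
    by (subst sum.swap) (simp add: sum_negf)
  finally show "boundary_map \<Delta> (boundary_map \<Delta> f) xs = 0"
    by (simp add: boundary_map_def)
qed

section \<open>Vanishing homology\<close>

text \<open>Vanishing homology on the level of chains, so that later arguments avoid quotient
  groups; the reverse inclusion is automatic for simplicial complexes.\<close>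

definition acyclic_at :: "'a set set \<Rightarrow> int \<Rightarrow> bool" where
  "acyclic_at \<Delta> i \<longleftrightarrow> cycles \<Delta> i \<subseteq> boundaries \<Delta> i"

lemma boundaries_subset_cycles:
  assumes "simplicial_complex \<Delta>"
  shows "boundaries \<Delta> i \<subseteq> cycles \<Delta> i"
proof
  fix b assume "b \<in> boundaries \<Delta> i"
  then obtain f where "f \<in> oriented_chains \<Delta> (i + 1)" "b = boundary_map \<Delta> f"
    unfolding boundaries_def by blast
  then show "b \<in> cycles \<Delta> i"
    using boundary_map_chain[OF assms, of f "i + 1"] boundary_map_boundary_map[of f]
    unfolding cycles_def by auto
qed

lemma comm_group_cycle_group: "comm_group (cycle_group \<Delta> i)"
proof (rule comm_groupI)
  fix f assume "f \<in> carrier (cycle_group \<Delta> i)"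
  then have "(\<lambda>xs. - f xs) \<in> carrier (cycle_group \<Delta> i)"
    by (simp add: cycle_group_def cycles_def oriented_chains_uminus boundary_map_uminus)
  then show "\<exists>g\<in>carrier (cycle_group \<Delta> i). g \<otimes>\<^bsub>cycle_group \<Delta> i\<^esub> f = \<one>\<^bsub>cycle_group \<Delta> i\<^esub>"
    by (rule rev_bexI) (simp add: cycle_group_def)
qed (auto simp: cycle_group_def cycles_def oriented_chains_add oriented_chains_zero
       boundary_map_add boundary_map_zero algebra_simps)

lemma subgroup_boundaries:
  assumes "simplicial_complex \<Delta>"
  shows "subgroup (boundaries \<Delta> i) (cycle_group \<Delta> i)"
proof -
  interpret comm_group "cycle_group \<Delta> i" by (rule comm_group_cycle_group)
  have sub: "boundaries \<Delta> i \<subseteq> carrier (cycle_group \<Delta> i)"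
    using boundaries_subset_cycles[OF assms] by (simp add: cycle_group_def)
  show ?thesis
  proof (rule subgroupI)
    show "boundaries \<Delta> i \<noteq> {}"
      unfolding boundaries_def using oriented_chains_zero by blast
  next
    fix b assume b: "b \<in> boundaries \<Delta> i"
    then obtain f where f: "f \<in> oriented_chains \<Delta> (i + 1)" "b = boundary_map \<Delta> f"
      unfolding boundaries_def by blast
    let ?b = "\<lambda>xs. - b xs"
    have mem: "?b \<in> boundaries \<Delta> i"
      unfolding boundaries_def using f
      by (intro image_eqI[OF _ oriented_chains_uminus[OF f(1)]]) (simp add: boundary_map_uminus)
    have "inv\<^bsub>cycle_group \<Delta> i\<^esub> b = ?b"
      using sub b mem by (intro inv_equality) (auto simp: cycle_group_def)
    then show "inv\<^bsub>cycle_group \<Delta> i\<^esub> b \<in> boundaries \<Delta> i" using mem by simp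
  next
    fix b c assume "b \<in> boundaries \<Delta> i" "c \<in> boundaries \<Delta> i"
    then obtain f g where "f \<in> oriented_chains \<Delta> (i + 1)" "b = boundary_map \<Delta> f"
      "g \<in> oriented_chains \<Delta> (i + 1)" "c = boundary_map \<Delta> g"
      unfolding boundaries_def by blast
    then show "b \<otimes>\<^bsub>cycle_group \<Delta> i\<^esub> c \<in> boundaries \<Delta> i"
      unfolding boundaries_def
      by (intro image_eqI[of _ _ "\<lambda>xs. f xs + g xs"] oriented_chains_add)
        (auto simp: cycle_group_def boundary_map_add)
  qed (fact sub)
qed

text \<open>The quotient is trivial iff every coset of the boundaries equals the subgroup of
  boundaries, and a coset does so exactly when its representative lies in the subgroup.\<close>

lemma trivial_reduced_homology_iff:
  assumes "simplicial_complex \<Delta>"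
  shows "trivial_group (reduced_homology \<Delta> i) \<longleftrightarrow> acyclic_at \<Delta> i"
proof -
  let ?Z = "cycle_group \<Delta> i" and ?B = "boundaries \<Delta> i"
  interpret comm_group ?Z by (rule comm_group_cycle_group)
  note B = subgroup_boundaries[OF assms, of i]
  interpret normal ?B ?Z by (rule subgroup_imp_normal[OF B])
  have group: "group (?Z Mod ?B)" by (rule factorgroup_is_group)
  have "trivial_group (?Z Mod ?B) \<longleftrightarrow> (\<forall>z\<in>carrier ?Z. ?B #>\<^bsub>?Z\<^esub> z = ?B)"
    unfolding group.trivial_group_subset[OF group] carrier_FactGroup one_FactGroup by blast
  also have "\<dots> \<longleftrightarrow> carrier ?Z \<subseteq> ?B"
    using coset_join1[OF _ _ B] coset_join2[OF _ B] by blast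
  finally show ?thesis
    by (simp add: reduced_homology_def acyclic_at_def cycle_group_def)
qed

text \<open>The instance of the Mayer--Vietoris sequence with outer terms zero.\<close>

lemma acyclic_at_union:
  assumes K: "simplicial_complex K" "acyclic_at K i"
    and L: "simplicial_complex L" "acyclic_at L i"
    and KL: "acyclic_at (K \<inter> L) (i - 1)"
  shows "acyclic_at (K \<union> L) i"
  unfolding acyclic_at_def
proof
  fix f assume "f \<in> cycles (K \<union> L) i"
  then have f: "f \<in> oriented_chains (K \<union> L) i" and f_cycle: "boundary_map (K \<union> L) f = (\<lambda>_. 0)"
    unfolding cycles_def by auto
  let ?D = "boundary_map (K \<union> L)"
  have fin: "finite (vertices (K \<union> L))"
    using simplicial_complexD(1)[OF K(1)] simplicial_complexD(1)[OF L(1)] by (simp add: vertices_def)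
  have D_K: "?D g = boundary_map K g" if "g \<in> oriented_chains K j" for g j
    using boundary_map_mono[OF that _ fin] by blast
  have D_L: "?D g = boundary_map L g" if "g \<in> oriented_chains L j" for g j
    using boundary_map_mono[OF that _ fin] by blast
  have D_KL: "?D g = boundary_map (K \<inter> L) g" if "g \<in> oriented_chains (K \<inter> L) j" for g j
    using boundary_map_mono[OF that _ fin] by blast
  define f1 where "f1 = (\<lambda>xs. if set xs \<in> K then f xs else 0)"
  \<comment> \<open>Defined by excluding \<open>K\<close>, yet a chain of \<open>L\<close>: a face
    of the union outside \<open>K\<close> lies in \<open>L\<close>.\<close>
  define f2 where "f2 = (\<lambda>xs. if set xs \<notin> K then f xs else 0)"
  have f_eq: "f = (\<lambda>xs. f1 xs + f2 xs)"
    by (auto simp: f1_def f2_def)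
  have f1: "f1 \<in> oriented_chains K i"
    unfolding f1_def by (rule oriented_chains_mono[OF oriented_chains_restrict[OF f]]) auto
  have f2: "f2 \<in> oriented_chains L i"
    unfolding f2_def by (rule oriented_chains_mono[OF oriented_chains_restrict[OF f]]) auto
  have sum_zero: "?D f1 xs + ?D f2 xs = 0" for xs
    using f_cycle unfolding f_eq boundary_map_add by (rule fun_cong)
  have b1: "?D f1 \<in> oriented_chains K (i - 1)"
    using boundary_map_chain[OF K(1) f1] D_K[OF f1] by simp
  have b2: "?D f2 \<in> oriented_chains L (i - 1)"
    using boundary_map_chain[OF L(1) f2] D_L[OF f2] by simp
  \<comment> \<open>As \<open>f\<close> is a cycle, the boundaries of \<open>f1\<close> and
    \<open>f2\<close> are negatives of each other, so their common support lies in both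
    complexes.\<close>
  have b: "?D f1 \<in> oriented_chains (K \<inter> L) (i - 1)"
  proof (rule oriented_chainsI)
    fix xs assume nz: "?D f1 xs \<noteq> 0"
    then have "?D f2 xs \<noteq> 0" using sum_zero[of xs] by linarith
    then show "distinct xs \<and> set xs \<in> K \<inter> L \<and> face_dim (set xs) = i - 1"
      using oriented_chains_support[OF b1 nz] oriented_chains_support[OF b2] by blast
  qed (rule oriented_chains_permute[OF b1])
  have "?D (?D f1) = (\<lambda>_. 0)"
    by (rule boundary_map_boundary_map[OF oriented_chains_mono[OF f1]]) auto
  then have "?D f1 \<in> cycles (K \<inter> L) (i - 1)"
    using b D_KL[OF b] by (simp add: cycles_def)
  then obtain g where g: "g \<in> oriented_chains (K \<inter> L) i" "?D f1 = boundary_map (K \<inter> L) g"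
    using KL unfolding acyclic_at_def boundaries_def by auto
  have gK: "g \<in> oriented_chains K i" and gL: "g \<in> oriented_chains L i"
    using g(1) by (auto intro: oriented_chains_mono)
  have D_g: "?D g = ?D f1" using g D_KL by simp
  \<comment> \<open>The chain \<open>g\<close> has the same boundary as \<open>f1\<close>; moving it
    from one summand to the other makes both of them cycles and keeps their sum
    \<open>f\<close>.\<close>
  note c1 = oriented_chains_diff[OF f1 gK]
  note c2 = oriented_chains_add[OF f2 gL]
  have "?D (\<lambda>xs. f1 xs - g xs) = (\<lambda>_. 0)"
    using D_g by (simp add: boundary_map_diff)
  then have "(\<lambda>xs. f1 xs - g xs) \<in> cycles K i"
    using c1 D_K[OF c1] by (simp add: cycles_def)
  then obtain h1 where h1: "h1 \<in> oriented_chains K (i + 1)" "(\<lambda>xs. f1 xs - g xs) = boundary_map K h1"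
    using K(2) unfolding acyclic_at_def boundaries_def by blast
  have "?D (\<lambda>xs. f2 xs + g xs) = (\<lambda>_. 0)"
    using D_g sum_zero by (simp add: boundary_map_add add.commute)
  then have "(\<lambda>xs. f2 xs + g xs) \<in> cycles L i"
    using c2 D_L[OF c2] by (simp add: cycles_def)
  then obtain h2 where h2: "h2 \<in> oriented_chains L (i + 1)" "(\<lambda>xs. f2 xs + g xs) = boundary_map L h2"
    using L(2) unfolding acyclic_at_def boundaries_def by blast
  have "f xs = ?D h1 xs + ?D h2 xs" for xs
    using fun_cong[OF h1(2), of xs] fun_cong[OF h2(2), of xs] D_K[OF h1(1)] D_L[OF h2(1)]
    by (simp add: f_eq)
  then have "f = ?D (\<lambda>xs. h1 xs + h2 xs)"
    by (simp add: boundary_map_add fun_eq_iff)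
  moreover have "(\<lambda>xs. h1 xs + h2 xs) \<in> oriented_chains (K \<union> L) (i + 1)"
    using h1(1) h2(1) by (intro oriented_chains_add) (auto intro: oriented_chains_mono)
  ultimately show "f \<in> boundaries (K \<union> L) i"
    unfolding boundaries_def by blast
qed

section \<open>Dimension and links\<close>

lemma face_dim_le_complex_dim:
  assumes "simplicial_complex \<Delta>" "\<sigma> \<in> \<Delta>"
  shows "face_dim \<sigma> \<le> complex_dim \<Delta>"
  unfolding complex_dim_def using assms simplicial_complex_finite(1) by (intro Max_ge) auto

lemma complex_dim_attained:
  assumes "simplicial_complex \<Delta>" "\<Delta> \<noteq> {}"
  obtains F where "F \<in> \<Delta>" "complex_dim \<Delta> = face_dim F"
proof -
  have "complex_dim \<Delta> \<in> face_dim ` \<Delta>"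
    unfolding complex_dim_def using assms simplicial_complex_finite(1) by (intro Max_in) auto
  then show ?thesis using that by blast
qed

lemma complex_dim_union:
  assumes "simplicial_complex X" "simplicial_complex Y" "X \<noteq> {}" "Y \<noteq> {}"
    and "complex_dim X = complex_dim Y"
  shows "complex_dim (X \<union> Y) = complex_dim X"
  using assms simplicial_complex_finite(1)[OF assms(1)] simplicial_complex_finite(1)[OF assms(2)]
  unfolding complex_dim_def by (simp add: image_Un Max_Un)

lemma simplicial_complex_union:
  "simplicial_complex X \<Longrightarrow> simplicial_complex Y \<Longrightarrow> simplicial_complex (X \<union> Y)"
  unfolding simplicial_complex_def vertices_def by auto

lemma simplicial_complex_link:
  assumes "simplicial_complex \<Delta>"
  shows "simplicial_complex (link \<Delta> \<sigma>)"
proof -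
  have "vertices (link \<Delta> \<sigma>) \<subseteq> vertices \<Delta>"
    unfolding vertices_def link_def by blast
  moreover have "\<tau> \<in> link \<Delta> \<sigma>" if "\<rho> \<in> link \<Delta> \<sigma>" "\<tau> \<subseteq> \<rho>" for \<rho> \<tau>
    using that simplicial_complexD(2)[OF assms, of \<rho> \<tau>]
      simplicial_complexD(2)[OF assms, of "\<rho> \<union> \<sigma>" "\<tau> \<union> \<sigma>"]
    unfolding link_def by auto
  ultimately show ?thesis
    using simplicial_complexD(1)[OF assms]
    unfolding simplicial_complex_def by (auto intro: finite_subset)
qed

lemma empty_mem_link:
  assumes "simplicial_complex \<Delta>" "\<sigma> \<in> \<Delta>"
  shows "{} \<in> link \<Delta> \<sigma>"
  using assms simplicial_complexD(2)[OF assms, of "{}"] unfolding link_def by auto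

lemma link_empty: "link \<Delta> {} = \<Delta>"
  unfolding link_def by auto

lemma link_eq_empty:
  assumes "simplicial_complex \<Delta>" "\<sigma> \<notin> \<Delta>"
  shows "link \<Delta> \<sigma> = {}"
  using assms simplicial_complexD(2) unfolding link_def by blast

lemma link_link:
  assumes "simplicial_complex \<Delta>"
  shows "link (link \<Delta> \<sigma>) \<tau> = (if \<tau> \<inter> \<sigma> = {} then link \<Delta> (\<sigma> \<union> \<tau>) else {})"
proof (cases "\<tau> \<inter> \<sigma> = {}")
  case True
  have "\<rho> \<in> link (link \<Delta> \<sigma>) \<tau> \<longleftrightarrow> \<rho> \<in> link \<Delta> (\<sigma> \<union> \<tau>)" for \<rho>
  proof
    assume "\<rho> \<in> link (link \<Delta> \<sigma>) \<tau>"
    then show "\<rho> \<in> link \<Delta> (\<sigma> \<union> \<tau>)"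
      unfolding link_def by (auto simp: Int_Un_distrib ac_simps)
  next
    assume *: "\<rho> \<in> link \<Delta> (\<sigma> \<union> \<tau>)"
    then have "\<rho> \<union> (\<sigma> \<union> \<tau>) \<in> \<Delta>" unfolding link_def by blast
    then have "\<rho> \<union> \<sigma> \<in> \<Delta>" "\<rho> \<union> \<tau> \<in> \<Delta>" "\<rho> \<union> \<tau> \<union> \<sigma> \<in> \<Delta>"
      by (auto intro: simplicial_complexD(2)[OF assms])
    then show "\<rho> \<in> link (link \<Delta> \<sigma>) \<tau>"
      using * True unfolding link_def by auto
  qed
  then show ?thesis using True by auto
next
  case False
  then show ?thesis unfolding link_def by auto
qed

text \<open>Closure under subsets excludes a mixed case: whichever complex contains
  \<open>\<tau> \<union> \<sigma>\<close> also contains \<tau>.\<close>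

lemma link_union:
  assumes "simplicial_complex X" "simplicial_complex Y"
  shows "link (X \<union> Y) \<sigma> = link X \<sigma> \<union> link Y \<sigma>"
proof
  show "link (X \<union> Y) \<sigma> \<subseteq> link X \<sigma> \<union> link Y \<sigma>"
  proof
    fix \<tau> assume "\<tau> \<in> link (X \<union> Y) \<sigma>"
    then have "\<tau> \<inter> \<sigma> = {}" "\<tau> \<union> \<sigma> \<in> X \<or> \<tau> \<union> \<sigma> \<in> Y"
      unfolding link_def by auto
    moreover have "\<tau> \<in> X" if "\<tau> \<union> \<sigma> \<in> X"
      using simplicial_complexD(2)[OF assms(1) that] by blast
    moreover have "\<tau> \<in> Y" if "\<tau> \<union> \<sigma> \<in> Y"
      using simplicial_complexD(2)[OF assms(2) that] by blast
    ultimately show "\<tau> \<in> link X \<sigma> \<union> link Y \<sigma>"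
      unfolding link_def by blast
  qed
qed (auto simp: link_def)

lemma link_inter: "link (X \<inter> Y) \<sigma> = link X \<sigma> \<inter> link Y \<sigma>"
  unfolding link_def by auto

section \<open>Cohen--Macaulay complexes\<close>

lemma cohen_macaulay_iff:
  "cohen_macaulay \<Delta> \<longleftrightarrow> simplicial_complex \<Delta> \<and>
     (\<forall>\<sigma>\<in>\<Delta>. \<forall>i < complex_dim (link \<Delta> \<sigma>). acyclic_at (link \<Delta> \<sigma>) i)"
  unfolding cohen_macaulay_def
  using trivial_reduced_homology_iff[OF simplicial_complex_link] by blast

text \<open>A link in a link is the link of the union of the two faces, so each instance of the
  condition is one for \<Delta>. This permits induction through vertex links.\<close>

lemma cohen_macaulay_link:
  assumes "cohen_macaulay \<Delta>"
  shows "cohen_macaulay (link \<Delta> \<sigma>)"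
  unfolding cohen_macaulay_iff
proof (intro conjI ballI allI impI)
  have \<Delta>: "simplicial_complex \<Delta>" using assms by (simp add: cohen_macaulay_def)
  show "simplicial_complex (link \<Delta> \<sigma>)" by (rule simplicial_complex_link[OF \<Delta>])
  fix \<tau> i assume "\<tau> \<in> link \<Delta> \<sigma>" "i < complex_dim (link (link \<Delta> \<sigma>) \<tau>)"
  moreover from this have "\<tau> \<inter> \<sigma> = {}" "\<sigma> \<union> \<tau> \<in> \<Delta>"
    unfolding link_def by (auto simp: Un_commute)
  ultimately show "acyclic_at (link (link \<Delta> \<sigma>) \<tau>) i"
    using assms by (simp add: link_link[OF \<Delta>] cohen_macaulay_iff)
qed

text \<open>Connectedness in terms of chains: the difference of two vertices bounds, and the boundary of
  a 1-chain has coefficient sum zero over every union of components.\<close>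

lemma acyclic_at_0_connected:
  assumes \<Delta>: "simplicial_complex \<Delta>" and acyclic: "acyclic_at \<Delta> 0"
    and w: "w \<in> S" "{w} \<in> \<Delta>" and v: "{v} \<in> \<Delta>"
    and closed: "\<And>x y. {x, y} \<in> \<Delta> \<Longrightarrow> x \<noteq> y \<Longrightarrow> x \<in> S \<Longrightarrow> y \<in> S"
  shows "v \<in> S"
proof (rule ccontr)
  assume "v \<notin> S"
  then have "v \<noteq> w" using w by blast
  let ?V = "vertices \<Delta>"
  have fin: "finite ?V" using \<Delta> by (rule simplicial_complexD)
  have vV: "v \<in> ?V" and wV: "w \<in> ?V" using v w unfolding vertices_def by auto
  \<comment> \<open>Homology being reduced, a 0-chain is a cycle only if its coefficients sum to 0,
    as 1 and -1 do here.\<close>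
  define c :: "'a list \<Rightarrow> int" where "c = (\<lambda>xs. of_bool (xs = [v]) - of_bool (xs = [w]))"
  have "c \<in> oriented_chains \<Delta> 0"
  proof (rule oriented_chainsI)
    fix xs assume "c xs \<noteq> 0"
    then have "xs = [v] \<or> xs = [w]" by (auto simp: c_def split: if_splits)
    then show "distinct xs \<and> set xs \<in> \<Delta> \<and> face_dim (set xs) = 0"
      using v w by (auto simp: face_dim_def)
  next
    fix xs :: "'a list" and \<pi> assume \<pi>: "\<pi> permutes {..<length xs}"
    show "c (permute_list \<pi> xs) = sign \<pi> * c xs"
    proof (cases "length xs = 1")
      case True
      then have "{..<length xs} = {0}" by auto
      then have "\<pi> = id" using \<pi> by simp
      then show ?thesis by simp
    next
      case False
      then have "c ys = 0" if "length ys = length xs" for ys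
        using that by (auto simp: c_def)
      then show ?thesis by simp
    qed
  qed
  moreover have "boundary_map \<Delta> c xs = 0" for xs
    using fin vV wV by (cases xs) (simp_all add: boundary_map_def c_def sum_subtractf of_bool_def)
  ultimately have "c \<in> cycles \<Delta> 0" by (auto simp: cycles_def)
  then obtain f where f: "f \<in> oriented_chains \<Delta> 1" and c: "c = boundary_map \<Delta> f"
    using acyclic unfolding acyclic_at_def boundaries_def by auto
  let ?S = "S \<inter> ?V"
  have finS: "finite ?S" using fin by simp
  \<comment> \<open>By \<open>closed\<close> no edge joins \<open>S\<close> to its complement, so
    the coefficients of \<open>c\<close> on \<open>S\<close> come from edges inside \<open>S\<close>
    only.\<close>
  have "(\<Sum>x\<in>?V. f [x, y]) = (\<Sum>x\<in>?S. f [x, y])" if "y \<in> ?S" for y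
  proof (intro sum.mono_neutral_right fin ballI)
    fix x assume x: "x \<in> ?V - ?S"
    show "f [x, y] = 0"
    proof (rule ccontr)
      assume "f [x, y] \<noteq> 0"
      then have "x \<noteq> y" "{x, y} \<in> \<Delta>" using oriented_chains_support[OF f] by force+
      then show False using closed[of y x] x that by (auto simp: insert_commute)
    qed
  qed auto
  then have "(\<Sum>y\<in>?S. c [y]) = (\<Sum>y\<in>?S. \<Sum>x\<in>?S. f [x, y])"
    unfolding c boundary_map_def by (rule sum.cong[OF refl])
  \<comment> \<open>Each edge inside \<open>S\<close> is counted once in each orientation, with
    opposite signs.\<close>
  also have "\<dots> = 0"
  proof -
    have "(\<Sum>y\<in>?S. \<Sum>x\<in>?S. f [x, y]) = (\<Sum>y\<in>?S. \<Sum>x\<in>?S. - f [y, x])"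
      by (intro sum.cong refl oriented_chains_swap[OF f])
    also have "\<dots> = - (\<Sum>x\<in>?S. \<Sum>y\<in>?S. f [y, x])"
      by (subst sum.swap) (simp add: sum_negf)
    finally show ?thesis by simp
  qed
  moreover have "(\<Sum>y\<in>?S. c [y]) = -1"
    using finS \<open>v \<notin> S\<close> w(1) wV by (simp add: c_def sum_subtractf of_bool_def)
  ultimately show False by simp
qed

text \<open>This is the purity of Cohen--Macaulay complexes. By induction it holds in the vertex links,
  so adjacent vertices have links of equal dimension; by connectedness all vertices do.\<close>

lemma cohen_macaulay_dim_link:
  assumes "cohen_macaulay \<Delta>" "\<sigma> \<in> \<Delta>"
  shows "complex_dim (link \<Delta> \<sigma>) = complex_dim \<Delta> - int (card \<sigma>)"
  using assms
proof (induction "card \<Delta>" arbitrary: \<Delta> \<sigma> rule: less_induct)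
  case (less \<Delta> \<sigma>)
  have \<Delta>: "simplicial_complex \<Delta>" using less.prems by (simp add: cohen_macaulay_def)
  have fin: "finite \<tau>" if "\<tau> \<in> \<Delta>" for \<tau>
    using simplicial_complex_finite(2)[OF \<Delta> that] .
  show ?case
  proof (cases "\<sigma> = {}")
    case True
    then show ?thesis by (simp add: link_empty)
  next
    case False
    then obtain v where v: "v \<in> \<sigma>" by blast
    define d where "d = (\<lambda>u. complex_dim (link \<Delta> {u}))"
    have vertex: "{u} \<in> \<Delta>" if "u \<in> \<tau>" "\<tau> \<in> \<Delta>" for u \<tau>
      using simplicial_complexD(2)[OF \<Delta> that(2)] that(1) by auto
    \<comment> \<open>The induction hypothesis applies to the link of \<open>u\<close>: it has fewer
      faces than \<Delta>, since \<open>{u}\<close> is a face of \<Delta> but not of the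
      link.\<close>
    have step: "complex_dim (link \<Delta> (insert u \<tau>)) = d u - int (card \<tau>)"
      if "insert u \<tau> \<in> \<Delta>" "u \<notin> \<tau>" for u \<tau>
    proof -
      have "link \<Delta> {u} \<subset> \<Delta>"
        using vertex[OF _ that(1), of u] unfolding link_def by blast
      then have "card (link \<Delta> {u}) < card \<Delta>"
        by (intro psubset_card_mono simplicial_complex_finite[OF \<Delta>])
      moreover have "\<tau> \<in> link \<Delta> {u}"
        using that simplicial_complexD(2)[OF \<Delta> that(1), of \<tau>] unfolding link_def by auto
      ultimately have "complex_dim (link (link \<Delta> {u}) \<tau>) = d u - int (card \<tau>)"
        unfolding d_def using less.prems(1) by (intro less.hyps cohen_macaulay_link)
      then show ?thesis using that by (simp add: link_link[OF \<Delta>])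
    qed
    \<comment> \<open>A largest face of the link extends by \<open>u\<close> to a face of
      \<Delta>.\<close>
    have upper: "d u \<le> complex_dim \<Delta> - 1" if u: "{u} \<in> \<Delta>" for u
    proof -
      obtain \<tau> where \<tau>: "\<tau> \<in> link \<Delta> {u}" "d u = face_dim \<tau>"
        using complex_dim_attained[OF simplicial_complex_link[OF \<Delta>]] empty_mem_link[OF \<Delta> u]
        unfolding d_def by blast
      then have "insert u \<tau> \<in> \<Delta>" "u \<notin> \<tau>" "finite \<tau>"
        using fin unfolding link_def by auto
      then show ?thesis
        using face_dim_le_complex_dim[OF \<Delta>, of "insert u \<tau>"] \<tau>(2) by (simp add: face_dim_def)
    qed
    \<comment> \<open>Deleting \<open>u\<close> from \<open>F\<close> leaves a face of the link.
      With \<open>upper\<close> this determines \<open>d u\<close> as soon as \<open>u\<close> lies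
      in a face of top dimension.\<close>
    have lower: "d u \<ge> face_dim F - 1" if "u \<in> F" "F \<in> \<Delta>" for u F
    proof -
      have "F - {u} \<in> link \<Delta> {u}"
        using that simplicial_complexD(2)[OF \<Delta> that(2), of "F - {u}"]
        unfolding link_def by (auto simp: insert_absorb)
      then have "face_dim (F - {u}) \<le> d u"
        unfolding d_def by (intro face_dim_le_complex_dim simplicial_complex_link[OF \<Delta>])
      moreover have "card F > 0" using fin that by (auto simp: card_gt_0_iff)
      ultimately show ?thesis using that fin[OF that(2)]
        by (simp add: face_dim_def)
    qed
    have "d v = complex_dim \<Delta> - 1"
    proof (cases "complex_dim \<Delta> > 0")
      case False
      have "face_dim \<sigma> \<ge> 0"
        using v fin[OF less.prems(2)] unfolding face_dim_def
        by (metis card_gt_0_iff diff_ge_0_iff_ge empty_iff int_one_le_iff_zero_less of_nat_0_less_iff)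
      then show ?thesis
        using False lower[OF v less.prems(2)] upper[OF vertex[OF v less.prems(2)]]
        by linarith
    next
      case True
      obtain F where F: "F \<in> \<Delta>" "complex_dim \<Delta> = face_dim F"
        using complex_dim_attained[OF \<Delta>] less.prems(2) by blast
      \<comment> \<open>At a vertex of a top-dimensional face the value of \<open>d\<close> is
        known; connectedness will carry it to \<open>v\<close>.\<close>
      with True obtain w where w: "w \<in> F" by (cases "F = {}") (auto simp: face_dim_def)
      have dw: "d w = complex_dim \<Delta> - 1"
        using upper[OF vertex[OF w F(1)]] lower[OF w F(1)] F(2) by linarith
      have "acyclic_at \<Delta> 0"
      proof -
        have "{} \<in> \<Delta>" using simplicial_complexD(2)[OF \<Delta> F(1)] by auto
        then show ?thesis
          using less.prems(1) True unfolding cohen_macaulay_iff by (metis link_empty)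
      qed
      then have "v \<in> {u. d u = d w}"
      proof (rule acyclic_at_0_connected[OF \<Delta>])
        show "{w} \<in> \<Delta>" "{v} \<in> \<Delta>"
          using vertex[OF w F(1)] vertex[OF v less.prems(2)] .
        \<comment> \<open>\<open>d x - 1\<close> and \<open>d y - 1\<close> are both the dimension
          of the link of the edge.\<close>
        fix x y assume xy: "{x, y} \<in> \<Delta>" "x \<noteq> y" "x \<in> {u. d u = d w}"
        then have "d x = d y"
          using step[of x "{y}"] step[of y "{x}"] by (simp add: insert_commute)
        then show "y \<in> {u. d u = d w}" using xy by simp
      qed simp
      then show ?thesis using dw by simp
    qed
    moreover have "complex_dim (link \<Delta> \<sigma>) = d v - int (card (\<sigma> - {v}))"
      using step[of v "\<sigma> - {v}"] v less.prems(2) by (simp add: insert_absorb)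
    moreover have "int (card \<sigma>) = int (card (\<sigma> - {v})) + 1"
      using card.remove[OF fin[OF less.prems(2)] v] by simp
    ultimately show ?thesis by linarith
  qed
qed

lemma cohen_macaulay_union:
  assumes X: "cohen_macaulay X" and Y: "cohen_macaulay Y" and XY: "cohen_macaulay (X \<inter> Y)"
    and dim: "complex_dim X = complex_dim Y" "complex_dim (X \<inter> Y) \<ge> complex_dim X - 1"
  shows "cohen_macaulay (X \<union> Y)"
  unfolding cohen_macaulay_iff
proof (intro conjI ballI allI impI)
  have sX: "simplicial_complex X" and sY: "simplicial_complex Y"
    using X Y by (simp_all add: cohen_macaulay_def)
  then show "simplicial_complex (X \<union> Y)" by (rule simplicial_complex_union)
  note link_XY = link_union[OF sX sY]
  fix \<sigma> i assume \<sigma>: "\<sigma> \<in> X \<union> Y" and i: "i < complex_dim (link (X \<union> Y) \<sigma>)"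
  \<comment> \<open>Off the intersection one of the two links is empty, and the other piece decides
    alone.\<close>
  consider "\<sigma> \<notin> Y" | "\<sigma> \<notin> X" | "\<sigma> \<in> X \<inter> Y" by blast
  then show "acyclic_at (link (X \<union> Y) \<sigma>) i"
  proof cases
    case 1
    then show ?thesis
      using \<sigma> i X link_eq_empty[OF sY] by (simp add: link_XY cohen_macaulay_iff)
  next
    case 2
    then show ?thesis
      using \<sigma> i Y link_eq_empty[OF sX] by (simp add: link_XY cohen_macaulay_iff)
  next
    case 3
    have sl: "simplicial_complex (link X \<sigma>)" "simplicial_complex (link Y \<sigma>)"
      using sX sY by (auto intro: simplicial_complex_link)
    have dims: "complex_dim (link X \<sigma>) = complex_dim X - int (card \<sigma>)"
      "complex_dim (link Y \<sigma>) = complex_dim X - int (card \<sigma>)"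
      "complex_dim (link (X \<inter> Y) \<sigma>) \<ge> complex_dim X - 1 - int (card \<sigma>)"
      using 3 X Y XY dim by (auto simp: cohen_macaulay_dim_link)
    have "link X \<sigma> \<noteq> {}" "link Y \<sigma> \<noteq> {}"
      using 3 empty_mem_link[OF sX, of \<sigma>] empty_mem_link[OF sY, of \<sigma>] by auto
    then have "complex_dim (link (X \<union> Y) \<sigma>) = complex_dim X - int (card \<sigma>)"
      using complex_dim_union[OF sl] dims by (simp add: link_XY)
    \<comment> \<open>Codimension at most 1 enters here:
      \<open>i < complex_dim X - card \<sigma>\<close> puts \<open>i - 1\<close> below
      \<open>complex_dim X - 1 - card \<sigma>\<close>, hence below the dimension of the link in the
      intersection.\<close>
    with i dims have "acyclic_at (link X \<sigma>) i" "acyclic_at (link Y \<sigma>) i"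
      "acyclic_at (link (X \<inter> Y) \<sigma>) (i - 1)"
      using 3 X Y XY unfolding cohen_macaulay_iff by simp_all
    then show ?thesis
      using sl unfolding link_XY link_inter by (intro acyclic_at_union)
  qed
qed

section \<open>Injective relabelling of vertices\<close>

lemma vertices_image: "vertices ((`) \<phi> ` \<Delta>) = \<phi> ` vertices \<Delta>"
  unfolding vertices_def by blast

lemma simplicial_complex_image:
  assumes "simplicial_complex \<Delta>"
  shows "simplicial_complex ((`) \<phi> ` \<Delta>)"
  using assms unfolding simplicial_complex_def vertices_image
  by (auto simp: subset_image_iff)

lemma face_dim_image: "inj \<phi> \<Longrightarrow> face_dim (\<phi> ` \<sigma>) = face_dim \<sigma>"
  unfolding face_dim_def by (simp add: card_image inj_on_subset)

lemma complex_dim_image: "inj \<phi> \<Longrightarrow> complex_dim ((`) \<phi> ` \<Delta>) = complex_dim \<Delta>"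
  unfolding complex_dim_def by (simp add: image_image face_dim_image)

lemma image_mem_image_iff: "inj \<phi> \<Longrightarrow> \<phi> ` \<sigma> \<in> (`) \<phi> ` \<Delta> \<longleftrightarrow> \<sigma> \<in> \<Delta>"
  by (auto simp: inj_image_eq_iff)

lemma link_image:
  assumes "inj \<phi>"
  shows "link ((`) \<phi> ` \<Delta>) (\<phi> ` \<sigma>) = (`) \<phi> ` link \<Delta> \<sigma>"
proof -
  have iff: "\<phi> ` \<tau> \<in> link ((`) \<phi> ` \<Delta>) (\<phi> ` \<sigma>) \<longleftrightarrow> \<tau> \<in> link \<Delta> \<sigma>" for \<tau>
    using image_mem_image_iff[OF assms]
    by (simp add: link_def flip: image_Int[OF assms] image_Un)
  show ?thesis
  proof (intro equalityI subsetI)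
    fix \<rho> assume \<rho>: "\<rho> \<in> link ((`) \<phi> ` \<Delta>) (\<phi> ` \<sigma>)"
    then obtain \<tau> where "\<rho> = \<phi> ` \<tau>" unfolding link_def by blast
    with \<rho> iff show "\<rho> \<in> (`) \<phi> ` link \<Delta> \<sigma>" by simp
  next
    fix \<rho> assume "\<rho> \<in> (`) \<phi> ` link \<Delta> \<sigma>"
    with iff show "\<rho> \<in> link ((`) \<phi> ` \<Delta>) (\<phi> ` \<sigma>)" by blast
  qed
qed

text \<open>A cycle of the image is pulled back along \<phi>, bounded there by some
  \<open>g\<close>, and \<open>g\<close> is transported forward again. Only lists with entries in
  the range of \<phi> can carry coefficients.\<close>

lemma acyclic_at_image:
  assumes \<phi>: "inj \<phi>" and acyclic: "acyclic_at \<Delta> i"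
  shows "acyclic_at ((`) \<phi> ` \<Delta>) i"
  unfolding acyclic_at_def
proof
  let ?\<Delta> = "(`) \<phi> ` \<Delta>"
  fix f assume "f \<in> cycles ?\<Delta> i"
  then have f: "f \<in> oriented_chains ?\<Delta> i" and f_cycle: "boundary_map ?\<Delta> f = (\<lambda>_. 0)"
    unfolding cycles_def by auto
  note mem = image_mem_image_iff[OF \<phi>]
  have sum_image: "(\<Sum>v\<in>vertices ?\<Delta>. h v) = (\<Sum>u\<in>vertices \<Delta>. h (\<phi> u))" for h :: "_ \<Rightarrow> int"
    unfolding vertices_image by (simp add: sum.reindex inj_on_subset[OF \<phi>])
  have "(\<lambda>xs. f (map \<phi> xs)) \<in> oriented_chains \<Delta> i"
  proof (rule oriented_chainsI)
    fix xs assume "f (map \<phi> xs) \<noteq> 0"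
    then show "distinct xs \<and> set xs \<in> \<Delta> \<and> face_dim (set xs) = i"
      using oriented_chains_support[OF f, of "map \<phi> xs"] mem face_dim_image[OF \<phi>]
      by (auto simp: distinct_map)
  next
    fix xs :: "'a list" and \<pi> assume "\<pi> permutes {..<length xs}"
    then show "f (map \<phi> (permute_list \<pi> xs)) = sign \<pi> * f (map \<phi> xs)"
      using oriented_chains_permute[OF f, of \<pi> "map \<phi> xs"] by (simp add: permute_list_map)
  qed
  moreover have "boundary_map \<Delta> (\<lambda>xs. f (map \<phi> xs)) xs = 0" for xs
    using fun_cong[OF f_cycle, of "map \<phi> xs"] by (simp add: boundary_map_def sum_image)
  ultimately obtain g where g: "g \<in> oriented_chains \<Delta> (i + 1)"
    and fg: "(\<lambda>xs. f (map \<phi> xs)) = boundary_map \<Delta> g"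
    using acyclic unfolding acyclic_at_def boundaries_def cycles_def by blast
  \<comment> \<open>The value 0 off the range is forced, since every face of the image complex lies
    in the range.\<close>
  define h where "h = (\<lambda>ys. if set ys \<subseteq> range \<phi> then g (map (inv_into UNIV \<phi>) ys) else 0)"
  have h_map: "h (map \<phi> xs) = g xs" for xs
    using \<phi> by (auto simp: h_def o_def)
  have in_range: "\<exists>xs. ys = map \<phi> xs" if "set ys \<subseteq> range \<phi>" for ys
    using that unfolding ex_map_conv by blast
  have "h \<in> oriented_chains ?\<Delta> (i + 1)"
  proof (rule oriented_chainsI)
    fix ys assume nz: "h ys \<noteq> 0"
    then obtain xs where ys: "ys = map \<phi> xs"
      using in_range[of ys] unfolding h_def by (auto split: if_splits)
    with nz have "g xs \<noteq> 0" by (simp add: h_map)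
    then show "distinct ys \<and> set ys \<in> ?\<Delta> \<and> face_dim (set ys) = i + 1"
      using oriented_chains_support[OF g, of xs] ys mem face_dim_image[OF \<phi>]
      by (auto simp: distinct_map intro: inj_on_subset[OF \<phi>])
  next
    fix ys :: "'b list" and \<pi> assume \<pi>: "\<pi> permutes {..<length ys}"
    show "h (permute_list \<pi> ys) = sign \<pi> * h ys"
    proof (cases "set ys \<subseteq> range \<phi>")
      case True
      then obtain xs where ys: "ys = map \<phi> xs" using in_range by blast
      then show ?thesis
        using \<pi> oriented_chains_permute[OF g, of \<pi> xs] by (simp add: permute_list_map h_map)
    next
      case False
      then show ?thesis using \<pi> by (simp add: h_def)
    qed
  qed
  moreover have "f ys = boundary_map ?\<Delta> h ys" for ys
  proof (cases "set ys \<subseteq> range \<phi>")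
    case True
    then obtain xs where ys: "ys = map \<phi> xs" using in_range by blast
    have "boundary_map ?\<Delta> h ys = (\<Sum>u\<in>vertices \<Delta>. h (map \<phi> (u # xs)))"
      by (simp add: boundary_map_def sum_image ys)
    then show ?thesis
      using fun_cong[OF fg, of xs] unfolding h_map by (simp add: boundary_map_def ys)
  next
    case False
    have "f ys = 0"
      using oriented_chains_support(2)[OF f, of ys] False by auto
    then show ?thesis using False by (simp add: boundary_map_def h_def)
  qed
  ultimately show "f \<in> boundaries ?\<Delta> i"
    unfolding boundaries_def by blast
qed

lemma cohen_macaulay_image:
  assumes "inj \<phi>" "cohen_macaulay \<Delta>"
  shows "cohen_macaulay ((`) \<phi> ` \<Delta>)"
  using assms unfolding cohen_macaulay_iff
  by (auto simp: simplicial_complex_image link_image complex_dim_image acyclic_at_image)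

section \<open>Gluing\<close>

lemma inj_copy_vertex: "inj (copy_vertex A j)"
  by (rule injI) (auto simp: copy_vertex_def split: if_splits)

lemma glue_copies_Suc:
  "glue_copies X A (Suc n) = glue_copies X A n \<union> (`) (copy_vertex A n) ` X"
  unfolding glue_copies_def by (simp add: lessThan_Suc Un_commute)

text \<open>The inducing vertex set may be replaced by \<open>vertices A\<close>, which is contained
  in it.\<close>

lemma induced_subcomplexD:
  assumes "induced_subcomplex A X"
  shows "A \<subseteq> X" "\<sigma> \<in> X \<Longrightarrow> \<sigma> \<subseteq> vertices A \<Longrightarrow> \<sigma> \<in> A"
  using assms unfolding induced_subcomplex_def vertices_def by blast+

lemma copy_vertex_image_eq_Inl:
  assumes "\<sigma> \<in> A"
  shows "copy_vertex A j ` \<sigma> = Inl ` \<sigma>"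
  using assms unfolding vertices_def copy_vertex_def by (auto intro!: image_cong)

text \<open>On faces of \<open>A\<close> every copy map agrees with \<open>Inl\<close>, so
  injectivity of the copy map gives the nontrivial direction.\<close>

lemma copy_vertex_image_mem_iff:
  "copy_vertex A j ` \<sigma> \<in> (`) Inl ` A \<longleftrightarrow> \<sigma> \<in> A"
proof
  assume "copy_vertex A j ` \<sigma> \<in> (`) Inl ` A"
  then obtain \<tau> where \<tau>: "\<tau> \<in> A" "copy_vertex A j ` \<sigma> = copy_vertex A j ` \<tau>"
    using copy_vertex_image_eq_Inl by (metis imageE)
  then show "\<sigma> \<in> A" using inj_image_eq_iff[OF inj_copy_vertex] by metis
qed (simp add: copy_vertex_image_eq_Inl)

text \<open>Distinct tags force a common face to have all its vertices in \<open>A\<close>;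
  inducedness is what then makes it a face of \<open>A\<close>.\<close>

lemma copies_inter:
  assumes "induced_subcomplex A X" "j \<noteq> l"
  shows "(`) (copy_vertex A j) ` X \<inter> (`) (copy_vertex A l) ` X = (`) Inl ` A"
proof (intro equalityI subsetI)
  fix \<rho> assume "\<rho> \<in> (`) (copy_vertex A j) ` X \<inter> (`) (copy_vertex A l) ` X"
  then obtain \<sigma> \<tau> where \<sigma>: "\<sigma> \<in> X" "\<rho> = copy_vertex A j ` \<sigma>" and \<tau>: "\<rho> = copy_vertex A l ` \<tau>"
    by blast
  have "x \<in> vertices A" if "x \<in> \<sigma>" for x
  proof -
    have "copy_vertex A j x \<in> copy_vertex A l ` \<tau>" using that \<sigma>(2) \<tau> by blast
    then show ?thesis using assms(2) by (auto simp: copy_vertex_def split: if_splits)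
  qed
  then have "\<sigma> \<in> A" using induced_subcomplexD(2)[OF assms(1) \<sigma>(1)] by blast
  then show "\<rho> \<in> (`) Inl ` A" using \<sigma>(2) by (simp add: copy_vertex_image_mem_iff)
next
  fix \<rho> :: "('a + 'a \<times> nat) set" assume "\<rho> \<in> (`) Inl ` A"
  then obtain \<sigma> where \<sigma>: "\<sigma> \<in> A" "\<rho> = Inl ` \<sigma>" by blast
  then have "\<rho> = copy_vertex A j ` \<sigma>" "\<rho> = copy_vertex A l ` \<sigma>"
    by (simp_all add: copy_vertex_image_eq_Inl)
  moreover have "\<sigma> \<in> X" using induced_subcomplexD(1)[OF assms(1)] \<sigma>(1) by blast
  ultimately show "\<rho> \<in> (`) (copy_vertex A j) ` X \<inter> (`) (copy_vertex A l) ` X" by blast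
qed

text \<open>The dimension is carried through the induction because gluing on the next copy requires
  two pieces of equal dimension. The induction starts from a single copy.\<close>

lemma cohen_macaulay_glue_copies:
  assumes X: "cohen_macaulay X" "X \<noteq> {}" and A: "cohen_macaulay A" "induced_subcomplex A X"
    and dim: "complex_dim A \<ge> complex_dim X - 1"
  shows "cohen_macaulay (glue_copies X A (Suc n)) \<and>
    complex_dim (glue_copies X A (Suc n)) = complex_dim X"
proof (induction n)
  case 0
  have "glue_copies X A (Suc 0) = (`) (copy_vertex A 0) ` X"
    unfolding glue_copies_def by auto
  then show ?case
    using X(1) by (simp add: cohen_macaulay_image inj_copy_vertex complex_dim_image)
next
  case (Suc n)
  let ?C = "glue_copies X A (Suc n)" and ?Y = "(`) (copy_vertex A (Suc n)) ` X"
  have Y: "cohen_macaulay ?Y" "complex_dim ?Y = complex_dim X"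
    using X(1) by (simp_all add: cohen_macaulay_image inj_copy_vertex complex_dim_image)
  have "?C \<inter> ?Y = (\<Union>j<Suc n. (`) (copy_vertex A j) ` X \<inter> ?Y)"
    unfolding glue_copies_def by blast
  also have "\<dots> = (\<Union>j<Suc n. (`) Inl ` A)"
    by (intro SUP_cong refl copies_inter[OF A(2)]) auto
  \<comment> \<open>The index set is nonempty, so the constant union is the image of
    \<open>A\<close> and not the empty family.\<close>
  also have "\<dots> = (`) Inl ` A" by auto
  finally have "cohen_macaulay (?C \<inter> ?Y)" "complex_dim (?C \<inter> ?Y) \<ge> complex_dim X - 1"
    using A(1) dim by (simp_all add: cohen_macaulay_image complex_dim_image)
  then have "cohen_macaulay (?C \<union> ?Y)"
    using Suc.IH Y by (intro cohen_macaulay_union) auto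
  moreover have "complex_dim (?C \<union> ?Y) = complex_dim ?C"
  proof (rule complex_dim_union)
    show "simplicial_complex ?C" "simplicial_complex ?Y"
      using Suc.IH Y(1) by (auto simp: cohen_macaulay_def)
    show "?C \<noteq> {}" "?Y \<noteq> {}" using X(2) by (auto simp: glue_copies_Suc)
  qed (use Suc.IH Y in simp)
  ultimately show ?case
    using Suc.IH unfolding glue_copies_Suc[of X A "Suc n"] by simp
qed

text \<open>A face above a face of a copy of \<open>X - A\<close> stays in that copy, so the
  intervals covering the copy have their tops there. Only a bottom in \<open>A\<close> can obstruct
  the restriction, and the pigeonhole principle yields a copy without one.\<close>

lemma partitionable_glue_copiesD:
  assumes X: "simplicial_complex X" and A: "finite A" "simplicial_complex A" "induced_subcomplex A X"
    and N: "N > card A" and partition: "partitionable (glue_copies X A N)"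
  shows "partitionable (X - A)"
proof -
  let ?C = "glue_copies X A N"
  define K where "K = ((`) Inl ` A :: ('a + 'a \<times> nat) set set)"
  define copy where "copy = (\<lambda>j. (`) (copy_vertex A j) ` X)"
  have copy_C: "copy j \<subseteq> ?C" if "j < N" for j
    using that unfolding copy_def glue_copies_def by blast
  have C_copy: "\<exists>j<N. \<sigma> \<in> copy j" if "\<sigma> \<in> ?C" for \<sigma>
    using that unfolding copy_def glue_copies_def by blast
  have inter: "copy j \<inter> copy l = K" if "j \<noteq> l" for j l
    unfolding copy_def K_def by (rule copies_inter[OF A(3) that])
  have copy_subset: "\<tau> \<in> copy j" if "\<sigma> \<in> copy j" "\<tau> \<subseteq> \<sigma>" for j \<sigma> \<tau>
    using simplicial_complexD(2)[OF simplicial_complex_image[OF X]] that unfolding copy_def by blast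
  have K_subset: "\<tau> \<in> K" if "\<sigma> \<in> K" "\<tau> \<subseteq> \<sigma>" for \<sigma> \<tau>
    using simplicial_complexD(2)[OF simplicial_complex_image[OF A(2)]] that unfolding K_def by blast
  obtain R where pure: "pure ?C"
    and R: "\<And>F. F \<in> facets ?C \<Longrightarrow> R F \<in> ?C \<and> R F \<subseteq> F"
    and disj: "disjoint_family_on (\<lambda>F. face_interval ?C (R F) F) (facets ?C)"
    and cover: "(\<Union>F\<in>facets ?C. face_interval ?C (R F) F) = ?C"
    using partition unfolding partitionable_def by blast
  \<comment> \<open>Each bottom belongs to its own interval, so equal bottoms would make two
    disjoint intervals meet.\<close>
  have R_inj: "F = G" if "F \<in> facets ?C" "G \<in> facets ?C" "R F = R G" for F G
  proof (rule ccontr)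
    assume "F \<noteq> G"
    moreover have "R F \<in> face_interval ?C (R F) F \<inter> face_interval ?C (R G) G"
      using R[OF that(1)] R[OF that(2)] that(3) unfolding face_interval_def by auto
    ultimately show False using disj that(1,2) unfolding disjoint_family_on_def by blast
  qed
  have "\<exists>j<N. \<forall>F\<in>facets ?C. F \<in> copy j - K \<longrightarrow> R F \<notin> K"
  proof (rule ccontr)
    assume "\<not> ?thesis"
    then have "\<forall>j. \<exists>F. j < N \<longrightarrow> F \<in> facets ?C \<and> F \<in> copy j - K \<and> R F \<in> K"
      by blast
    then obtain G where "\<forall>j. j < N \<longrightarrow> G j \<in> facets ?C \<and> G j \<in> copy j - K \<and> R (G j) \<in> K"
      by (rule choice[THEN exE])
    then have G: "\<And>j. j < N \<Longrightarrow> G j \<in> facets ?C \<and> G j \<in> copy j - K \<and> R (G j) \<in> K"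
      by blast
    \<comment> \<open>If every copy were spoiled by a facet \<open>G j\<close>, these facets would
      differ, as copies are disjoint outside \<open>K\<close>; their bottoms would then be
      \<open>N\<close> distinct faces in \<open>K\<close>.\<close>
    have "inj_on (\<lambda>j. R (G j)) {..<N}"
    proof (rule inj_onI, rule ccontr)
      fix j l assume jl: "j \<in> {..<N}" "l \<in> {..<N}" "R (G j) = R (G l)" "j \<noteq> l"
      then have "G j = G l" using R_inj G by blast
      then have "G j \<in> copy j \<inter> copy l - K" using G[of j] G[of l] jl by auto
      then show False using inter[OF jl(4)] by blast
    qed
    then have "card {..<N} \<le> card K"
      using G A(1) unfolding K_def by (intro card_inj_on_le[of "\<lambda>j. R (G j)"]) auto
    also have "\<dots> \<le> card A" unfolding K_def by (rule card_image_le[OF A(1)])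
    finally show False using N by simp
  qed
  then obtain j where j: "j < N"
    and good: "\<And>F. F \<in> facets ?C \<Longrightarrow> F \<in> copy j - K \<Longrightarrow> R F \<notin> K"
    by blast
  let ?\<phi> = "copy_vertex A j" and ?Q = "X - A"
  note inj = inj_copy_vertex[of A j]
  have Q_iff: "?\<phi> ` \<sigma> \<in> copy j - K \<longleftrightarrow> \<sigma> \<in> ?Q" for \<sigma>
    unfolding copy_def K_def by (simp add: image_mem_image_iff[OF inj] copy_vertex_image_mem_iff)
  have Q_C: "?\<phi> ` \<sigma> \<in> ?C" if "\<sigma> \<in> ?Q" for \<sigma>
    using that copy_C[OF j] unfolding copy_def by blast
  have preimage: "\<exists>\<sigma>\<in>?Q. \<rho> = ?\<phi> ` \<sigma>" if "\<rho> \<in> copy j - K" for \<rho>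
    using that Q_iff unfolding copy_def by blast
  \<comment> \<open>Some copy \<open>l\<close> contains the larger face and hence the smaller one;
    as the latter is outside \<open>K\<close>, no copy but \<open>j\<close> qualifies.\<close>
  have above: "\<rho> \<in> copy j - K" if Q: "\<sigma> \<in> ?Q" and sub: "?\<phi> ` \<sigma> \<subseteq> \<rho>" and C: "\<rho> \<in> ?C" for \<sigma> \<rho>
  proof -
    have \<sigma>: "?\<phi> ` \<sigma> \<in> copy j - K" using Q Q_iff by blast
    obtain l where "\<rho> \<in> copy l" using C_copy[OF C] by blast
    then have "?\<phi> ` \<sigma> \<in> copy j \<inter> copy l - K" using copy_subset sub \<sigma> by blast
    then have "l = j" using inter[of j l] by blast
    then show ?thesis using \<open>\<rho> \<in> copy l\<close> K_subset[OF _ sub] \<sigma> by blast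
  qed
  \<comment> \<open>By \<open>above\<close>, everything in the glued complex that could contradict
    maximality comes from \<open>X - A\<close> in the same copy.\<close>
  have facet_iff: "?\<phi> ` F \<in> facets ?C \<longleftrightarrow> F \<in> facets ?Q" if F: "F \<in> ?Q" for F
  proof
    assume "?\<phi> ` F \<in> facets ?C"
    then have max: "\<rho> = ?\<phi> ` F" if "\<rho> \<in> ?C" "?\<phi> ` F \<subseteq> \<rho>" for \<rho>
      using that unfolding facets_def by simp
    have "\<sigma> = F" if "\<sigma> \<in> ?Q" "F \<subseteq> \<sigma>" for \<sigma>
    proof -
      have "?\<phi> ` \<sigma> = ?\<phi> ` F"
        by (rule max[OF Q_C[OF that(1)] image_mono[OF that(2)]])
      then show ?thesis using inj by (simp add: inj_image_eq_iff)
    qed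
    then show "F \<in> facets ?Q" using F unfolding facets_def by simp
  next
    assume "F \<in> facets ?Q"
    then have max: "\<sigma> = F" if "\<sigma> \<in> ?Q" "F \<subseteq> \<sigma>" for \<sigma>
      using that unfolding facets_def by simp
    have "\<rho> = ?\<phi> ` F" if \<rho>: "\<rho> \<in> ?C" "?\<phi> ` F \<subseteq> \<rho>" for \<rho>
    proof -
      obtain \<sigma> where \<sigma>: "\<sigma> \<in> ?Q" "\<rho> = ?\<phi> ` \<sigma>" using preimage[OF above[OF F \<rho>(2,1)]] by blast
      then have "F \<subseteq> \<sigma>" using \<rho>(2) inj by (simp add: inj_image_subset_iff)
      then show ?thesis using max[OF \<sigma>(1)] \<sigma>(2) by simp
    qed
    then show "?\<phi> ` F \<in> facets ?C" using Q_C[OF F] unfolding facets_def by simp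
  qed
  have facet_Q: "F \<in> ?Q" "?\<phi> ` F \<in> facets ?C" if "F \<in> facets ?Q" for F
  proof -
    show "F \<in> ?Q" using that unfolding facets_def by simp
    then show "?\<phi> ` F \<in> facets ?C" using that facet_iff by simp
  qed
  \<comment> \<open>The bottom lies in copy \<open>j\<close> as a subset of its facet, and outside
    \<open>K\<close> by the choice of \<open>j\<close>; it therefore pulls back to a bottom in
    \<open>X - A\<close>.\<close>
  have "\<exists>\<sigma>\<in>?Q. R (?\<phi> ` F) = ?\<phi> ` \<sigma>" if F: "F \<in> facets ?Q" for F
  proof (rule preimage)
    have "?\<phi> ` F \<in> copy j - K" using facet_Q(1)[OF F] Q_iff by blast
    then show "R (?\<phi> ` F) \<in> copy j - K"
      using good[OF facet_Q(2)[OF F]] R[OF facet_Q(2)[OF F]] copy_subset by blast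
  qed
  then obtain S where S: "\<And>F. F \<in> facets ?Q \<Longrightarrow> S F \<in> ?Q \<and> R (?\<phi> ` F) = ?\<phi> ` S F"
    by metis
  have interval: "\<sigma> \<in> face_interval ?Q (S F) F \<longleftrightarrow>
      ?\<phi> ` \<sigma> \<in> face_interval ?C (R (?\<phi> ` F)) (?\<phi> ` F)" if "F \<in> facets ?Q" "\<sigma> \<in> ?Q" for F \<sigma>
    using S[OF that(1)] that(2) Q_C[OF that(2)] inj
    unfolding face_interval_def by (simp add: inj_image_subset_iff)
  show ?thesis
    unfolding partitionable_def
  proof (intro conjI exI ballI)
    show "pure ?Q"
      unfolding pure_def
    proof (intro ballI)
      fix F G assume "F \<in> facets ?Q" "G \<in> facets ?Q"
      then have "face_dim (?\<phi> ` F) = face_dim (?\<phi> ` G)"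
        using pure facet_Q(2) unfolding pure_def by blast
      then show "face_dim F = face_dim G" by (simp add: face_dim_image[OF inj])
    qed
  next
    fix F assume F: "F \<in> facets ?Q"
    show "S F \<in> ?Q" using S[OF F] by blast
    show "S F \<subseteq> F"
      using S[OF F] R[OF facet_Q(2)[OF F]] inj by (simp add: inj_image_subset_iff)
  next
    show "disjoint_family_on (\<lambda>F. face_interval ?Q (S F) F) (facets ?Q)"
      unfolding disjoint_family_on_def
    proof (intro ballI impI equals0I)
      fix F G \<sigma> assume F: "F \<in> facets ?Q" and G: "G \<in> facets ?Q" and "F \<noteq> G"
        and \<sigma>: "\<sigma> \<in> face_interval ?Q (S F) F \<inter> face_interval ?Q (S G) G"
      have "\<sigma> \<in> ?Q" using \<sigma> unfolding face_interval_def by blast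
      with \<sigma> have "?\<phi> ` \<sigma> \<in> face_interval ?C (R (?\<phi> ` F)) (?\<phi> ` F) \<inter>
          face_interval ?C (R (?\<phi> ` G)) (?\<phi> ` G)"
        using interval[OF F] interval[OF G] by blast
      moreover have "?\<phi> ` F \<noteq> ?\<phi> ` G" using \<open>F \<noteq> G\<close> inj by (simp add: inj_image_eq_iff)
      ultimately show False
        using disj facet_Q(2)[OF F] facet_Q(2)[OF G] unfolding disjoint_family_on_def by blast
    qed
  next
    show "(\<Union>F\<in>facets ?Q. face_interval ?Q (S F) F) = ?Q"
    proof (intro equalityI subsetI)
      fix \<sigma> assume \<sigma>: "\<sigma> \<in> ?Q"
      obtain G where G: "G \<in> facets ?C" "?\<phi> ` \<sigma> \<in> face_interval ?C (R G) G"
        using cover Q_C[OF \<sigma>] by blast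
      \<comment> \<open>The top of the covering interval contains a face of copy \<open>j\<close>
        outside \<open>K\<close>, so it is itself the copy of a facet of
        \<open>X - A\<close>.\<close>
      then have "?\<phi> ` \<sigma> \<subseteq> G" "G \<in> ?C" unfolding face_interval_def facets_def by blast+
      then obtain F where F: "F \<in> ?Q" "G = ?\<phi> ` F" using preimage[OF above[OF \<sigma>]] by blast
      then have "F \<in> facets ?Q" using facet_iff G(1) by blast
      then show "\<sigma> \<in> (\<Union>F\<in>facets ?Q. face_interval ?Q (S F) F)"
        using interval[OF _ \<sigma>] G(2) F(2) by blast
    qed (auto simp: face_interval_def)
  qed
qed

theorem theorem3p1:
  fixes X A :: "'a set set" and N :: nat
  assumes "relative_complex X A"
    and "cohen_macaulay X" and "cohen_macaulay A"
    and "induced_subcomplex A X"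
    and "complex_dim A \<ge> complex_dim X - 1"
    and "\<not> partitionable (X - A)"
    and "N > card A"
  shows "cohen_macaulay (glue_copies X A N) \<and> \<not> partitionable (glue_copies X A N)"
proof
  have X: "simplicial_complex X" and A: "simplicial_complex A"
    using assms by (simp_all add: cohen_macaulay_def)
  \<comment> \<open>The empty family is partitionable with no intervals at all, so
    non-partitionability rules it out.\<close>
  have "X \<noteq> {}"
  proof
    assume "X = {}"
    then have "partitionable (X - A)"
      by (simp add: partitionable_def pure_def facets_def disjoint_family_on_def)
    then show False using assms(6) by contradiction
  qed
  moreover obtain n where "N = Suc n" using assms(7) by (cases N) auto
  ultimately show "cohen_macaulay (glue_copies X A N)"
    using cohen_macaulay_glue_copies[OF assms(2) _ assms(3,4,5)] by blast
  show "\<not> partitionable (glue_copies X A N)"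
    using partitionable_glue_copiesD[OF X simplicial_complex_finite(1)[OF A] A assms(4,7)] assms(6)
    by blast
qed

end
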